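(* Let $\varepsilon,\delta>0$, and let $(E)$ be a satisfiable set of $d$ experimental equations (for one qubit, in one variable) such that the size of every equation is at most $k$, where $k\ge1$ is an integer. If $(E)$ is $(\varepsilon,\delta)$-robust, then there exists an $(\varepsilon/(3k),\delta)$-tester for $\mathcal{F}_{(E)}$ which makes $O(d\ln(d)/\varepsilon^2)$ queries.
   Context: A one-qubit density matrix is a positive semidefinite Hermitian $2\times2$ matrix of trace $1$ (and an $m\times m$ density matrix is defined likewise). A one-qubit superoperator is a linear map on $\mathbb{C}^{2\times2}$; a superoperator is a PSO if it sends density matrices to density matrices; $\mathbf{G}$ is a CPSO if $\mathbf{G}\otimes\mathbf{I}_M$ is a PSO for every positive integer $M$, where $\mathbf{I}_M$ is the identity on $\mathbb{C}^{M\times M}$. $\mathrm{Pr}^0[\rho]=\langle0|\rho|0\rangle$ is the probability of measuring $|0\rangle\langle 0|$. An experimental equation (one qubit, one variable) is an equation $\mathrm{Pr}^0[\mathbf{G}^{j}(|b\rangle\langle b|)]=r$ in the unknown one-qubit CPSO $\mathbf{G}$, where $j$ is a non-negative integer (the size of the equation), $b\in\{0,1\}$ and $0\le r\le1$. For $\varepsilon\ge0$, $\mathbf{G}$ $\varepsilon$-satisfies it if $|\mathrm{Pr}^0[\mathbf{G}^{j}(|b\rangle\langle b|)]-r|\le\varepsilon$, and satisfies it if this holds with $\varepsilon=0$. $\mathbf{G}$ ($\varepsilon$-)satisfies a finite set $(E)$ of such equations if it ($\varepsilon$-)satisfies each one. $(E)$ is satisfiable if some CPSO satisfies it; $\mathcal{F}_{(E)}$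 is the set of all one-qubit CPSOs satisfying $(E)$. $\|V\|_1=\mathrm{Tr}\sqrt{V^\dagger V}$ for a matrix $V$, $\|\mathbf{G}\|_\infty=\sup\{\|\mathbf{G}(V)\|_1:\|V\|_1=1\}$ for a superoperator $\mathbf{G}$, and $\mathrm{dist}_\infty$ is the distance induced by $\|\cdot\|_\infty$ (distance to a set being the infimum). For $\varepsilon,\delta\ge0$, a finite satisfiable set $(E)$ of experimental equations is $(\varepsilon,\delta)$-robust if whenever a CPSO $\mathbf{G}$ $\varepsilon$-satisfies $(E)$, we have $\mathrm{dist}_\infty(\mathbf{G},\mathcal{F}_{(E)})\le\delta$. The experimental oracle $\mathcal{O}[\mathbf{G}]$ of a one-qubit CPSO $\mathbf{G}$ is a probabilistic procedure that takes inputs $(b,j)\in\{0,1\}\times\mathbb{N}$ and returns an outcome in $\{0,1\}$, equal to $0$ with probability $\mathrm{Pr}^0[\mathbf{G}^{j}(|b\rangle\langle b|)]$; separate queries are separate (independent) runs of the procedure. An oracle program $T$ with experimental oracle $\mathcal{O}[\mathbf{G}]$, denoted $T^{\mathcal{O}[\mathbf{G}]}$, is a program that can present queries $(b,j)$ to the oracle and receives in one computational step the probabilistic outcome of $\mathcal{O}[\mathbf{G}]$ on the query. For a family $\mathcal{F}$ of CPSOs and $0\le\delta_1\le\delta_2<1$, a $(\delta_1,\delta_2)$-tester for $\mathcal{F}$ is a probabilistic oracle program $T$ such that for every CPSO $\mathbf{G}$: if $\mathrm{dist}_\infty(\mathbf{G},\mathcal{F})\le\delta_1$ then $\Pr[T^{\mathcal{O}[\mathbf{G}]}\text{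 says PASS}]\ge2/3$; if $\mathrm{dist}_\infty(\mathbf{G},\mathcal{F})>\delta_2$ then $\Pr[T^{\mathcal{O}[\mathbf{G}]}\text{ says FAIL}]\ge2/3$; the probability is over the outcomes of the experimental oracle and the internal coin tosses of the program. *)

theory Defs
  imports
    "HOL-Probability.Probability_Mass_Function"
    "Jordan_Normal_Form.Schur_Decomposition"
begin

definition mat_trace :: "complex mat \<Rightarrow> complex" where
  "mat_trace A = (\<Sum>i<dim_row A. A $$ (i, i))"

definition psd :: "nat \<Rightarrow> complex mat \<Rightarrow> bool" where
  "psd n A \<longleftrightarrow> A \<in> carrier_mat n n \<and> mat_adjoint A = A \<and>
     (\<forall>v \<in> carrier_vec n. 0 \<le> Re ((A *\<^sub>v v) \<bullet>c v))"

definition density :: "nat \<Rightarrow> complex mat \<Rightarrow> bool" where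
  "density n \<rho> \<longleftrightarrow> psd n \<rho> \<and> mat_trace \<rho> = 1"

text \<open>
  A superoperator on the complex n by n matrices is a function on all matrices, of which only
  the restriction to \<^term>\<open>carrier_mat n n\<close> matters.
\<close>

definition superoperator :: "nat \<Rightarrow> (complex mat \<Rightarrow> complex mat) \<Rightarrow> bool" where
  "superoperator n G \<longleftrightarrow>
     (\<forall>A \<in> carrier_mat n n. G A \<in> carrier_mat n n) \<and>
     (\<forall>A \<in> carrier_mat n n. \<forall>B \<in> carrier_mat n n. G (A + B) = G A + G B) \<and>
     (\<forall>c. \<forall>A \<in> carrier_mat n n. G (c \<cdot>\<^sub>m A) = c \<cdot>\<^sub>m G A)"

definition pso :: "nat \<Rightarrow> (complex mat \<Rightarrow> complex mat) \<Rightarrow> bool" where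
  "pso n G \<longleftrightarrow> superoperator n G \<and> (\<forall>\<rho>. density n \<rho> \<longrightarrow> density n (G \<rho>))"

text \<open>
  The basis vector indexed by the pair of i < n and a < M has index i * M + a. With this
  convention \<^term>\<open>kron n M A B\<close> is the usual Kronecker product, and \<^term>\<open>tensor_id n M G\<close>
  is the tensor product of G with the identity superoperator on the M by M matrices: it applies
  G to each of the M * M slices of V in which the indices of the second factor are fixed.
  The lemma \<open>tensor_id_kron\<close> below shows that it acts as required on product matrices; as
  these span, this determines it for linear G.
\<close>

definition kron :: "nat \<Rightarrow> nat \<Rightarrow> complex mat \<Rightarrow> complex mat \<Rightarrow> complex mat" where
  "kron n M A B = mat (n * M) (n * M)
     (\<lambda>(p, q). A $$ (p div M, q div M) * B $$ (p mod M, q mod M))"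

definition tensor_id ::
  "nat \<Rightarrow> nat \<Rightarrow> (complex mat \<Rightarrow> complex mat) \<Rightarrow> complex mat \<Rightarrow> complex mat" where
  "tensor_id n M G V = mat (n * M) (n * M)
     (\<lambda>(p, q). G (mat n n (\<lambda>(i, j). V $$ (i * M + p mod M, j * M + q mod M)))
                 $$ (p div M, q div M))"

lemma tensor_id_kron:
  assumes G: "superoperator n G" and A: "A \<in> carrier_mat n n" and B: "B \<in> carrier_mat M M"
  shows "tensor_id n M G (kron n M A B) = kron n M (G A) B"
proof (rule eq_matI)
  fix p q
  assume "p < dim_row (kron n M (G A) B)" and "q < dim_col (kron n M (G A) B)"
  then have p: "p < n * M" and q: "q < n * M" by (auto simp: kron_def)
  then have M: "M > 0" by (cases M) auto
  have pd: "p div M < n" and qd: "q div M < n"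
    using p q by (auto simp: less_mult_imp_div_less)
  have idx: "i * M + a < n * M" if "i < n" "a < M" for i a
  proof -
    have "i * M + a < Suc i * M" using that by simp
    also have "\<dots> \<le> n * M" using that by (intro mult_le_mono1) simp
    finally show ?thesis .
  qed
  let ?b = "B $$ (p mod M, q mod M)"
  have "mat n n (\<lambda>(i, j). kron n M A B $$ (i * M + p mod M, j * M + q mod M)) = ?b \<cdot>\<^sub>m A"
    using A M by (intro eq_matI) (auto simp: kron_def idx)
  moreover have "G (?b \<cdot>\<^sub>m A) = ?b \<cdot>\<^sub>m G A" "G A \<in> carrier_mat n n"
    using G A by (auto simp: superoperator_def)
  ultimately show "tensor_id n M G (kron n M A B) $$ (p, q) = kron n M (G A) B $$ (p, q)"
    using p q pd qd by (auto simp: tensor_id_def kron_def)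
qed (auto simp: tensor_id_def kron_def)

definition cpso :: "(complex mat \<Rightarrow> complex mat) \<Rightarrow> bool" where
  "cpso G \<longleftrightarrow> superoperator 2 G \<and> (\<forall>M>0. pso (2 * M) (tensor_id 2 M G))"

definition psd_sqrt :: "complex mat \<Rightarrow> complex mat" where
  "psd_sqrt A = (THE B. psd (dim_row A) B \<and> B * B = A)"

definition trace_norm :: "complex mat \<Rightarrow> real" where
  "trace_norm V = Re (mat_trace (psd_sqrt (mat_adjoint V * V)))"

text \<open>
  Extended reals make the supremum and the infimum total, so that the distance to the empty
  family is infinite.
\<close>

definition norm_inf :: "(complex mat \<Rightarrow> complex mat) \<Rightarrow> ereal" where
  "norm_inf G = (SUP V \<in> {V \<in> carrier_mat 2 2. trace_norm V = 1}. ereal (trace_norm (G V)))"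

definition dist_inf ::
  "(complex mat \<Rightarrow> complex mat) \<Rightarrow> (complex mat \<Rightarrow> complex mat) set \<Rightarrow> ereal" where
  "dist_inf G \<F> = (INF H \<in> \<F>. norm_inf (\<lambda>V. G V - H V))"

text \<open>The bits 0 and 1 are encoded as \<^const>\<open>False\<close> and \<^const>\<open>True\<close>.\<close>

definition ket_bra :: "bool \<Rightarrow> complex mat" where
  "ket_bra b = mat 2 2 (\<lambda>(i, j). of_bool (i = of_bool b \<and> j = of_bool b))"

definition Pr0 :: "complex mat \<Rightarrow> real" where
  "Pr0 \<rho> = Re (\<rho> $$ (0, 0))"

datatype equation = Equation (eq_bit: bool) (eq_size: nat) (eq_prob: real)

definition experimental_equation :: "equation \<Rightarrow> bool" where
  "experimental_equation e \<longleftrightarrow> 0 \<le> eq_prob e \<and> eq_prob e \<le> 1"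

definition eps_satisfies ::
  "real \<Rightarrow> (complex mat \<Rightarrow> complex mat) \<Rightarrow> equation set \<Rightarrow> bool" where
  "eps_satisfies \<epsilon> G E \<longleftrightarrow>
     (\<forall>e \<in> E. \<bar>Pr0 ((G ^^ eq_size e) (ket_bra (eq_bit e))) - eq_prob e\<bar> \<le> \<epsilon>)"

definition solutions :: "equation set \<Rightarrow> (complex mat \<Rightarrow> complex mat) set" where
  "solutions E = {G. cpso G \<and> eps_satisfies 0 G E}"

definition satisfiable :: "equation set \<Rightarrow> bool" where
  "satisfiable E \<longleftrightarrow> (\<exists>G. cpso G \<and> eps_satisfies 0 G E)"

definition robust :: "real \<Rightarrow> real \<Rightarrow> equation set \<Rightarrow> bool" where
  "robust \<epsilon> \<delta> E \<longleftrightarrow>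
     (\<forall>G. cpso G \<and> eps_satisfies \<epsilon> G E \<longrightarrow> dist_inf G (solutions E) \<le> ereal \<delta>)"

text \<open>\<^const>\<open>bernoulli_pmf\<close> p returns \<^const>\<open>True\<close> with probability p; outcome 0 is
  \<^const>\<open>False\<close>, hence the negation.\<close>

definition experimental_oracle ::
  "(complex mat \<Rightarrow> complex mat) \<Rightarrow> bool \<Rightarrow> nat \<Rightarrow> bool pmf" where
  "experimental_oracle G b j = map_pmf Not (bernoulli_pmf (Pr0 ((G ^^ j) (ket_bra b))))"

datatype verdict = PASS | FAIL

text \<open>
  An oracle program is given by its finite tree of runs: it halts with a verdict, tosses a fair
  coin, or presents a query and continues depending on the outcome. Queries are adaptive, and
  every such tree is a finite object, hence can be hard-wired into a terminating program.
\<close>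

datatype oracle_program =
    Halt verdict
  | Toss "bool \<Rightarrow> oracle_program"
  | Query bool nat "bool \<Rightarrow> oracle_program"

primrec run :: "(bool \<Rightarrow> nat \<Rightarrow> bool pmf) \<Rightarrow> oracle_program \<Rightarrow> verdict pmf" where
  "run \<O> (Halt v) = return_pmf v"
| "run \<O> (Toss T) = bind_pmf (bernoulli_pmf (1 / 2)) (\<lambda>c. run \<O> (T c))"
| "run \<O> (Query b j T) = bind_pmf (\<O> b j) (\<lambda>x. run \<O> (T x))"

primrec queries :: "oracle_program \<Rightarrow> nat" where
  "queries (Halt v) = 0"
| "queries (Toss T) = max (queries (T False)) (queries (T True))"
| "queries (Query b j T) = Suc (max (queries (T False)) (queries (T True)))"

text \<open>
  The notion is meant for 0 \<open>\<le>\<close> \<open>\<delta>\<^sub>1\<close> \<open>\<le>\<close> \<open>\<delta>\<^sub>2\<close> < 1, but the two conditions make sense for all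
  real parameters, so the range is not built in.
\<close>

definition tester ::
  "real \<Rightarrow> real \<Rightarrow> (complex mat \<Rightarrow> complex mat) set \<Rightarrow> oracle_program \<Rightarrow> bool" where
  "tester \<delta>\<^sub>1 \<delta>\<^sub>2 \<F> T \<longleftrightarrow>
     (\<forall>G. cpso G \<longrightarrow>
        (dist_inf G \<F> \<le> ereal \<delta>\<^sub>1 \<longrightarrow> pmf (run (experimental_oracle G) T) PASS \<ge> 2 / 3) \<and>
        (dist_inf G \<F> > ereal \<delta>\<^sub>2 \<longrightarrow> pmf (run (experimental_oracle G) T) FAIL \<ge> 2 / 3))"

end

theory Submission
  imports Defs "HOL-Probability.Hoeffding"
begin

text \<open>
  The density matrices on one qubit form the Bloch ball of radius 1/2, and the trace norm of the
  difference of two of them is twice the Euclidean distance of their Bloch vectors. If two Bloch vectors lie at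
  distance s, their difference is s times a diameter of the ball, so an affine self-map of the
  ball does not increase distances. By telescoping, G and H with norm distance at most 2 \<eta> have
  j-th iterates whose outcome probabilities differ by at most j \<eta>. Thus a CPSO within
  \<epsilon>/(3k) of a solution satisfies every equation up to \<epsilon>/3, while by robustness one further than
  \<delta> away violates some equation by more than \<epsilon>. The tester estimates each probability
  from O(ln d / \<epsilon>^2) samples and compares with the threshold 2\<epsilon>/3; by Hoeffding's
  inequality each comparison errs with probability at most 1/(3d).
\<close>

section \<open>Hermitian 2 by 2 matrices: positivity, square roots and trace norm\<close>

definition herm_mat :: "real \<Rightarrow> real \<Rightarrow> complex \<Rightarrow> complex mat" where
  "herm_mat a q z = mat 2 2 (\<lambda>(i, j). if i = 0 then (if j = 0 then of_real a else z)
                                else (if j = 0 then cnj z else of_real q))"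

lemma herm_mat_carrier [simp]: "herm_mat a q z \<in> carrier_mat 2 2"
  by (simp add: herm_mat_def)

lemma herm_mat_dim [simp]: "dim_row (herm_mat a q z) = 2" "dim_col (herm_mat a q z) = 2"
  by (simp_all add: herm_mat_def)

lemma herm_mat_index [simp]:
  "herm_mat a q z $$ (0, 0) = of_real a" "herm_mat a q z $$ (0, Suc 0) = z"
  "herm_mat a q z $$ (Suc 0, 0) = cnj z" "herm_mat a q z $$ (Suc 0, Suc 0) = of_real q"
  by (simp_all add: herm_mat_def)

lemma eq_mat_2I:
  assumes "A \<in> carrier_mat 2 2" "B \<in> carrier_mat 2 2"
    and "A $$ (0, 0) = B $$ (0, 0)" "A $$ (0, Suc 0) = B $$ (0, Suc 0)"
    and "A $$ (Suc 0, 0) = B $$ (Suc 0, 0)" "A $$ (Suc 0, Suc 0) = B $$ (Suc 0, Suc 0)"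
  shows "A = B"
proof (rule eq_matI)
  fix i j assume "i < dim_row B" "j < dim_col B"
  then have "(i = 0 \<or> i = Suc 0) \<and> (j = 0 \<or> j = Suc 0)"
    using assms(2) by auto
  then show "A $$ (i, j) = B $$ (i, j)" using assms by auto
qed (use assms in auto)

lemma herm_mat_eq_iff [simp]: "herm_mat a q z = herm_mat a' q' z' \<longleftrightarrow> a = a' \<and> q = q' \<and> z = z'"
  by (metis herm_mat_index of_real_eq_iff)

lemma mat_adjoint_index:
  fixes A :: "complex mat"
  assumes "i < dim_col A" "j < dim_row A"
  shows "mat_adjoint A $$ (i, j) = cnj (A $$ (j, i))"
  using assms by (simp add: mat_adjoint_def mat_of_rows_def)

lemma mat_adjoint_carrier:
  assumes "A \<in> carrier_mat n m" shows "mat_adjoint A \<in> carrier_mat m n"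
  using assms by (auto simp: mat_adjoint_def)

lemma mat_adjoint_herm_mat [simp]: "mat_adjoint (herm_mat a q z) = herm_mat a q z"
  by (rule eq_mat_2I) (simp_all add: mat_adjoint_index mat_adjoint_carrier)

lemma herm_mat_mult:
  "herm_mat a q z * herm_mat a q z = herm_mat (a\<^sup>2 + (cmod z)\<^sup>2) (q\<^sup>2 + (cmod z)\<^sup>2) (of_real (a + q) * z)"
proof -
  have "z * cnj z = of_real ((cmod z)\<^sup>2)" using complex_norm_square[of z] by simp
  moreover have "herm_mat a q z * herm_mat a q z \<in> carrier_mat 2 2"
    by (rule mult_carrier_mat[of _ 2 2]) simp_all
  moreover have "{0..<2} = {0, Suc 0}" by auto
  ultimately show ?thesis
    by (intro eq_mat_2I) (simp_all add: scalar_prod_def power2_eq_square algebra_simps)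
qed

lemma mat_trace_herm_mat: "mat_trace (herm_mat a q z) = of_real (a + q)"
  by (simp add: mat_trace_def numeral_2_eq_2)

lemma herm_mat_quadratic:
  "Re ((herm_mat a q z *\<^sub>v vec_of_list [x, y]) \<bullet>c vec_of_list [x, y]) =
     a * (cmod x)\<^sup>2 + q * (cmod y)\<^sup>2 + 2 * Re (z * y * cnj x)"
proof -
  have "Re ((herm_mat a q z *\<^sub>v vec_of_list [x, y]) \<bullet>c vec_of_list [x, y]) =
    Re ((of_real a * x + z * y) * cnj x + (cnj z * x + of_real q * y) * cnj y)"
    by (simp add: scalar_prod_def numeral_2_eq_2 vec_of_list_index row_def)
  also have "\<dots> = a * (cmod x)\<^sup>2 + q * (cmod y)\<^sup>2 + 2 * Re (z * y * cnj x)"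
    unfolding cmod_power2 by (simp add: power2_eq_square algebra_simps)
  finally show ?thesis .
qed

text \<open>Suitable test vectors force the diagonal and the determinant to be nonnegative.
  Conversely, the arithmetic-geometric mean inequality bounds the cross term of the quadratic form
  by the diagonal terms.\<close>

lemma psd_2_herm_mat: "psd 2 (herm_mat a q z) \<longleftrightarrow> 0 \<le> a \<and> 0 \<le> q \<and> (cmod z)\<^sup>2 \<le> a * q"
proof
  assume "psd 2 (herm_mat a q z)"
  then have form: "0 \<le> a * (cmod x)\<^sup>2 + q * (cmod y)\<^sup>2 + 2 * Re (z * y * cnj x)" for x y
  proof -
    have "vec_of_list [x, y] \<in> carrier_vec 2"
      using carrier_vec_dim_vec[of "vec_of_list [x, y]"] by (simp add: numeral_2_eq_2)
    with \<open>psd 2 (herm_mat a q z)\<close> show ?thesis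
      unfolding herm_mat_quadratic[symmetric] psd_def by blast
  qed
  have a: "0 \<le> a" using form[of 1 0] by simp
  have q: "0 \<le> q" using form[of 0 1] by simp
  have z2: "Re (z * cnj z) = (cmod z)\<^sup>2" by (simp add: complex_norm_square[symmetric])
  \<comment> \<open>At \<open>(z, -a)\<close> the form equals \<open>a\<close> times the
    determinant, at \<open>(q, -cnj z)\<close> it equals \<open>q\<close> times the determinant. A
    zero diagonal makes both vacuous and is settled by \<open>(z, -1)\<close>.\<close>
  have "0 \<le> a * (a * q - (cmod z)\<^sup>2)"
    using form[of z "- of_real a"] z2
    by (simp add: power2_eq_square cmod_power2[unfolded power2_eq_square] algebra_simps)
  moreover have "0 \<le> q * (a * q - (cmod z)\<^sup>2)"
    using form[of "of_real q" "- cnj z"] z2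
    by (simp add: power2_eq_square cmod_power2[unfolded power2_eq_square] algebra_simps)
  moreover have "(cmod z)\<^sup>2 \<le> 0" if "a = 0" "q = 0"
    using form[of z "-1"] that unfolding cmod_power2 by (simp add: power2_eq_square)
  moreover have "a > 0 \<or> q > 0 \<or> a = 0 \<and> q = 0" using a q by auto
  ultimately have "(cmod z)\<^sup>2 \<le> a * q"
    by (auto simp: zero_le_mult_iff)
  with a q show "0 \<le> a \<and> 0 \<le> q \<and> (cmod z)\<^sup>2 \<le> a * q" by simp
next
  assume *: "0 \<le> a \<and> 0 \<le> q \<and> (cmod z)\<^sup>2 \<le> a * q"
  have "0 \<le> Re ((herm_mat a q z *\<^sub>v v) \<bullet>c v)" if v: "v \<in> carrier_vec 2" for v
  proof -
    obtain x y where vxy: "v = vec_of_list [x, y]"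
    proof
      show "v = vec_of_list [v $ 0, v $ 1]"
      proof (rule eq_vecI)
        fix i assume "i < dim_vec (vec_of_list [v $ 0, v $ 1])"
        then have "i = 0 \<or> i = Suc 0" by auto
        then show "v $ i = vec_of_list [v $ 0, v $ 1] $ i" by (elim disjE) simp_all
      qed (use v in simp)
    qed
    have "cmod z \<le> sqrt a * sqrt q"
      using * by (simp add: real_le_rsqrt flip: real_sqrt_mult)
    then have "cmod z * (cmod y * cmod x) \<le> (sqrt a * sqrt q) * (cmod y * cmod x)"
      by (rule mult_right_mono) simp
    then have "\<bar>Re (z * y * cnj x)\<bar> \<le> (sqrt a * sqrt q) * (cmod y * cmod x)"
      using abs_Re_le_cmod[of "z * y * cnj x"] by (simp add: norm_mult mult.assoc)
    moreover have "2 * ((sqrt a * sqrt q) * (cmod y * cmod x)) \<le> (sqrt a * cmod x)\<^sup>2 + (sqrt q * cmod y)\<^sup>2"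
      using sum_squares_bound[of "sqrt a * cmod x" "sqrt q * cmod y"] by (simp add: mult_ac)
    moreover have "(sqrt a * cmod x)\<^sup>2 + (sqrt q * cmod y)\<^sup>2 = a * (cmod x)\<^sup>2 + q * (cmod y)\<^sup>2"
      using * by (simp add: power_mult_distrib)
    ultimately show ?thesis unfolding vxy herm_mat_quadratic by linarith
  qed
  then show "psd 2 (herm_mat a q z)" by (simp add: psd_def)
qed

lemma psd_2_obtain_herm_mat:
  assumes "psd 2 A"
  obtains a q z where "A = herm_mat a q z" "0 \<le> a" "0 \<le> q" "(cmod z)\<^sup>2 \<le> a * q"
proof -
  have A: "A \<in> carrier_mat 2 2" and adj: "mat_adjoint A = A"
    using assms by (auto simp: psd_def)
  have herm: "A $$ (i, j) = cnj (A $$ (j, i))" if "i < 2" "j < 2" for i j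
    using mat_adjoint_index[of i A j] A adj that by auto
  have real: "A $$ (i, i) = of_real (Re (A $$ (i, i)))" if "i < 2" for i
    using herm[of i i] that by (metis Reals_cnj_iff complex_is_Real_iff of_real_Re)
  have "A = herm_mat (Re (A $$ (0, 0))) (Re (A $$ (Suc 0, Suc 0))) (A $$ (0, Suc 0))"
    using real[of 0] real[of 1] herm[of 1 0] by (intro eq_mat_2I A) simp_all
  then show thesis using that assms psd_2_herm_mat by metis
qed

text \<open>As \<open>psd_sqrt\<close> is a definite description, the content is uniqueness of the
  positive root, obtained by comparing the entries of the two squares.\<close>

lemma psd_sqrt_square:
  assumes A: "psd 2 A" shows "psd_sqrt (A * A) = A"
  unfolding psd_sqrt_def
proof (rule the_equality)
  have dim: "dim_row (A * A) = 2" using A by (auto simp: psd_def)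
  then show "psd (dim_row (A * A)) A \<and> A * A = A * A" using A by simp
  fix B assume "psd (dim_row (A * A)) B \<and> B * B = A * A"
  then have B: "psd 2 B" and BA: "B * B = A * A" using dim by simp_all
  obtain a q z where Ah: "A = herm_mat a q z" and a: "0 \<le> a" "0 \<le> q" "(cmod z)\<^sup>2 \<le> a * q"
    using A by (rule psd_2_obtain_herm_mat)
  obtain b r w where Bh: "B = herm_mat b r w" and b: "0 \<le> b" "0 \<le> r" "(cmod w)\<^sup>2 \<le> b * r"
    using B by (rule psd_2_obtain_herm_mat)
  have e1: "b\<^sup>2 + (cmod w)\<^sup>2 = a\<^sup>2 + (cmod z)\<^sup>2"
    and e2: "r\<^sup>2 + (cmod w)\<^sup>2 = q\<^sup>2 + (cmod z)\<^sup>2"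
    and e3: "of_real (b + r) * w = of_real (a + q) * z"
    using BA unfolding Ah Bh herm_mat_mult by simp_all
  have e4: "(b + r)\<^sup>2 * (cmod w)\<^sup>2 = (a + q)\<^sup>2 * (cmod z)\<^sup>2"
    using arg_cong[OF e3, of "\<lambda>x. (cmod x)\<^sup>2"] by (simp add: norm_mult power_mult_distrib del: of_real_add)
  \<comment> \<open>The square determines the determinant, hence also the trace, of a positive root.\<close>
  have det: "(x * y - n)\<^sup>2 = (x\<^sup>2 + n) * (y\<^sup>2 + n) - (x + y)\<^sup>2 * n" for x y n :: real
    by (simp add: power2_eq_square algebra_simps)
  have "(b * r - (cmod w)\<^sup>2)\<^sup>2 = (a * q - (cmod z)\<^sup>2)\<^sup>2"
    unfolding det e1 e2 e4 ..
  then have "b * r - (cmod w)\<^sup>2 = a * q - (cmod z)\<^sup>2"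
    using a b by (simp add: power2_eq_iff_nonneg)
  then have "(b + r)\<^sup>2 = (a + q)\<^sup>2"
    using e1 e2 by (simp add: power2_sum)
  then have tr: "b + r = a + q"
    using a b by (simp add: power2_eq_iff_nonneg)
  \<comment> \<open>A positive matrix of trace zero vanishes. Otherwise \<open>e3\<close> can be
    divided by the common trace, after which \<open>e1\<close> and \<open>e2\<close> fix the
    diagonal.\<close>
  show "B = A"
  proof (cases "a + q = 0")
    case True
    then have "a = 0" "q = 0" "b = 0" "r = 0" using a b tr by auto
    then show ?thesis using a b by (simp add: Ah Bh)
  next
    case False
    then have "w = z" using e3 tr by (metis mult_cancel_left of_real_eq_0_iff)
    then have "b = a" "r = q" using e1 e2 a b by (simp_all add: power2_eq_iff_nonneg)
    then show ?thesis using \<open>w = z\<close> by (simp add: Ah Bh)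
  qed
qed

text \<open>A density matrix is its own absolute value. This makes it admissible in the supremum
  that defines \<open>norm_inf\<close>.\<close>

lemma trace_norm_density:
  assumes "density 2 \<rho>" shows "trace_norm \<rho> = 1"
  using assms psd_sqrt_square[of \<rho>] by (simp add: trace_norm_def density_def psd_def)

text \<open>The square of a traceless Hermitian matrix is scalar, so its absolute value is
  \<open>s\<close> times the identity, of trace \<open>2 * s\<close>.\<close>

lemma trace_norm_traceless: "trace_norm (herm_mat a (- a) z) = 2 * norm (a, z)"
proof -
  define s where "s = sqrt (a\<^sup>2 + (cmod z)\<^sup>2)"
  have "herm_mat a (- a) z * herm_mat a (- a) z = herm_mat s s 0 * herm_mat s s 0"
    unfolding herm_mat_mult by (simp add: s_def)
  moreover have "psd_sqrt (herm_mat s s 0 * herm_mat s s 0) = herm_mat s s 0"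
    by (intro psd_sqrt_square) (simp add: psd_2_herm_mat s_def)
  ultimately show ?thesis
    by (simp add: trace_norm_def mat_trace_herm_mat norm_prod_def s_def)
qed

section \<open>Density matrices as points of the Bloch ball\<close>

text \<open>This is half the customary Bloch vector, up to the sign of one coordinate, shifted so
  that the first coordinate is \<open>Pr0\<close>. The product norm on pairs is Euclidean.\<close>

definition bloch :: "complex mat \<Rightarrow> real \<times> complex" where
  "bloch A = (Re (A $$ (0, 0)), A $$ (0, 1))"

definition bloch_mat :: "real \<times> complex \<Rightarrow> complex mat" where
  "bloch_mat x = herm_mat (fst x) (1 - fst x) (snd x)"

definition bloch_ball :: "(real \<times> complex) set" where
  "bloch_ball = cball (1 / 2, 0) (1 / 2)"

lemma bloch_bloch_mat [simp]: "bloch (bloch_mat x) = x"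
  by (simp add: bloch_def bloch_mat_def)

lemma bloch_mat_carrier [simp]: "bloch_mat x \<in> carrier_mat 2 2"
  by (simp add: bloch_mat_def)

text \<open>For trace 1 the determinant condition becomes the equation of a ball after completing
  the square in \<open>a\<close>.\<close>

lemma density_bloch_mat: "density 2 (bloch_mat x) \<longleftrightarrow> x \<in> bloch_ball"
proof -
  obtain a z where x: "x = (a, z)" by force
  have "sqrt (1 / 4) = (1 / 2 :: real)" by (simp add: real_sqrt_divide)
  then have "x \<in> bloch_ball \<longleftrightarrow> (dist (1 / 2) a)\<^sup>2 + (cmod z)\<^sup>2 \<le> 1 / 4"
    unfolding bloch_ball_def mem_cball x dist_Pair_Pair
    by (metis dist_0_norm real_sqrt_le_iff)
  also have "\<dots> \<longleftrightarrow> (cmod z)\<^sup>2 \<le> a * (1 - a)"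
    by (auto simp: dist_real_def power2_eq_square algebra_simps)
  \<comment> \<open>If the product is nonnegative, so are both factors: they sum to 1 and cannot
    both be nonpositive.\<close>
  also have "\<dots> \<longleftrightarrow> 0 \<le> a \<and> 0 \<le> 1 - a \<and> (cmod z)\<^sup>2 \<le> a * (1 - a)"
    using order_trans[OF zero_le_power2, of "cmod z" "a * (1 - a)"]
    by (auto simp: zero_le_mult_iff)
  also have "\<dots> \<longleftrightarrow> density 2 (bloch_mat x)"
    by (simp add: density_def psd_2_herm_mat bloch_mat_def x mat_trace_herm_mat)
  finally show ?thesis by simp
qed

lemma bloch_mat_bloch:
  assumes "density 2 \<rho>" shows "bloch_mat (bloch \<rho>) = \<rho>"
proof -
  obtain a q z where "\<rho> = herm_mat a q z"
    using assms psd_2_obtain_herm_mat unfolding density_def by metis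
  moreover have "q = 1 - a"
    using assms unfolding density_def \<open>\<rho> = herm_mat a q z\<close> mat_trace_herm_mat
    by (metis add_diff_cancel_left' of_real_eq_1_iff)
  ultimately show ?thesis by (simp add: bloch_def bloch_mat_def)
qed

lemma bloch_density: "density 2 \<rho> \<Longrightarrow> bloch \<rho> \<in> bloch_ball"
  using bloch_mat_bloch density_bloch_mat by metis

lemma density_carrier: "density n \<rho> \<Longrightarrow> \<rho> \<in> carrier_mat n n"
  by (simp add: density_def psd_def)

lemma trace_norm_diff_density:
  assumes "density 2 \<rho>" "density 2 \<sigma>"
  shows "trace_norm (\<rho> - \<sigma>) = 2 * dist (bloch \<rho>) (bloch \<sigma>)"
proof -
  define x y where "x = bloch \<rho>" and "y = bloch \<sigma>"
  have "\<rho> - \<sigma> = bloch_mat x - bloch_mat y"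
    using assms by (simp add: x_def y_def bloch_mat_bloch)
  also have "\<dots> = herm_mat (fst (x - y)) (- fst (x - y)) (snd (x - y))"
    by (intro eq_mat_2I minus_carrier_mat) (simp_all add: bloch_mat_def)
  finally show ?thesis
    by (simp add: trace_norm_traceless dist_norm x_def y_def del: fst_diff snd_diff)
qed

lemma abs_Pr0_diff_le: "\<bar>Pr0 \<rho> - Pr0 \<sigma>\<bar> \<le> dist (bloch \<rho>) (bloch \<sigma>)"
  using dist_fst_le[of "bloch \<rho>" "bloch \<sigma>"] by (simp add: Pr0_def bloch_def dist_real_def)

lemma Pr0_density:
  assumes "density 2 \<rho>" shows "0 \<le> Pr0 \<rho>" "Pr0 \<rho> \<le> 1"
proof -
  have "dist (1 / 2) (fst (bloch \<rho>)) \<le> 1 / 2"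
    using bloch_density[OF assms] dist_fst_le[of "(1 / 2, 0)" "bloch \<rho>"]
    by (simp add: bloch_ball_def)
  then show "0 \<le> Pr0 \<rho>" "Pr0 \<rho> \<le> 1"
    unfolding Pr0_def bloch_def dist_real_def fst_conv abs_le_iff by linarith+
qed

lemma density_ket_bra: "density 2 (ket_bra b)"
proof -
  have "ket_bra b = bloch_mat (of_bool (\<not> b), 0)"
    by (intro eq_mat_2I) (auto simp: ket_bra_def bloch_mat_def)
  then show ?thesis
    by (simp add: density_bloch_mat bloch_ball_def dist_Pair_Pair dist_real_def)
qed

section \<open>Superoperators as contractions of the Bloch ball\<close>

text \<open>Take \<open>M = 1\<close>: tensoring with a one-dimensional identity changes nothing on
  \<open>carrier_mat 2 2\<close>.\<close>

lemma cpso_imp_pso: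
  assumes "cpso G" shows "pso 2 G"
proof -
  have sup: "superoperator 2 G" and "\<forall>M>0. pso (2 * M) (tensor_id 2 M G)"
    using assms unfolding cpso_def by simp_all
  from this(2)[rule_format, of 1] have pso: "pso 2 (tensor_id 2 1 G)" by simp
  have tensor: "tensor_id 2 1 G V = G V" if V: "V \<in> carrier_mat 2 2" for V
  proof -
    have slice: "mat 2 2 (\<lambda>(i, j). V $$ (i * 1 + p mod 1, j * 1 + q mod 1)) = V" for p q :: nat
      using V by (intro eq_matI) auto
    have GV: "G V \<in> carrier_mat 2 2" using sup V unfolding superoperator_def by blast
    show ?thesis
      unfolding tensor_id_def slice using GV by (intro eq_matI) auto
  qed
  have "density 2 (G \<rho>)" if "density 2 \<rho>" for \<rho>
  proof -
    have "density 2 (tensor_id 2 1 G \<rho>)" using pso that unfolding pso_def by simp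
    then show ?thesis unfolding tensor[OF density_carrier[OF that]] .
  qed
  then show ?thesis using sup by (simp add: pso_def)
qed

text \<open>By linearity the image of the chord is \<open>s\<close> times the image of a parallel
  diameter, whose endpoints stay in a ball of diameter 1.\<close>

lemma pso_dist_bloch_le:
  assumes G: "pso 2 G" and \<rho>: "density 2 \<rho>" and \<sigma>: "density 2 \<sigma>"
  shows "dist (bloch (G \<rho>)) (bloch (G \<sigma>)) \<le> dist (bloch \<rho>) (bloch \<sigma>)"
proof (cases "bloch \<rho> = bloch \<sigma>")
  case True
  then have "\<rho> = \<sigma>" using bloch_mat_bloch[OF \<rho>] bloch_mat_bloch[OF \<sigma>] by metis
  then show ?thesis by simp
next
  case False
  define x y s where "x = bloch \<rho>" and "y = bloch \<sigma>" and "s = dist x y"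
  have s: "s > 0" using False by (simp add: s_def x_def y_def)
  \<comment> \<open>The radius of length 1/2 in the direction of the chord; \<open>p\<close> and
    \<open>m\<close> are the endpoints of the parallel diameter.\<close>
  define v where "v = (1 / (2 * s)) *\<^sub>R (x - y)"
  define c :: "real \<times> complex" where "c = (1 / 2, 0)"
  define p m where "p = c + v" and "m = c - v"
  have "norm v = \<bar>1 / (2 * s)\<bar> * s" by (simp only: v_def norm_scaleR s_def dist_norm)
  then have "norm v = 1 / 2" using s by simp
  then have pm: "density 2 (bloch_mat p)" "density 2 (bloch_mat m)"
    unfolding density_bloch_mat bloch_ball_def c_def[symmetric] p_def m_def
    by (simp_all add: dist_norm)
  \<comment> \<open>This is \<open>x - y = s (p - m)\<close> without subtraction, because
    \<open>superoperator\<close> provides only sums and scalar multiples.\<close>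
  have xy: "x + s *\<^sub>R m = y + s *\<^sub>R p"
  proof -
    have "x - y = (2 * s) *\<^sub>R v" using s by (simp add: v_def)
    also have "\<dots> = s *\<^sub>R (v + v)" by (simp add: scaleR_2[symmetric] mult.commute)
    also have "v + v = p - m" by (simp add: p_def m_def)
    finally show ?thesis by (simp only: scaleR_diff_right diff_eq_eq diff_add_eq eq_diff_eq add.commute)
  qed
  have "bloch_mat x + of_real s \<cdot>\<^sub>m bloch_mat m = bloch_mat y + of_real s \<cdot>\<^sub>m bloch_mat p"
  proof -
    have f: "fst x + s * fst m = fst y + s * fst p" using arg_cong[OF xy, of fst] by simp
    have g: "snd x + of_real s * snd m = snd y + of_real s * snd p"
      using arg_cong[OF xy, of snd] by (simp add: scaleR_conv_of_real)
    have h: "1 - fst x + s * (1 - fst m) = 1 - fst y + s * (1 - fst p)"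
      using f by (simp add: algebra_simps)
    have comb: "bloch_mat u + of_real s \<cdot>\<^sub>m bloch_mat w =
        herm_mat (fst u + s * fst w) (1 - fst u + s * (1 - fst w)) (snd u + of_real s * snd w)" for u w
      by (intro eq_mat_2I add_carrier_mat smult_carrier_mat) (simp_all add: bloch_mat_def)
    show ?thesis unfolding comb f g h ..
  qed
  then have "G (\<rho> + of_real s \<cdot>\<^sub>m bloch_mat m) = G (\<sigma> + of_real s \<cdot>\<^sub>m bloch_mat p)"
    using \<rho> \<sigma> by (simp add: x_def y_def bloch_mat_bloch)
  then have lin: "G \<rho> + of_real s \<cdot>\<^sub>m G (bloch_mat m) = G \<sigma> + of_real s \<cdot>\<^sub>m G (bloch_mat p)"
    using G density_carrier[OF \<rho>] density_carrier[OF \<sigma>] by (simp add: pso_def superoperator_def)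
  have Gd: "density 2 (G \<tau>)" if "density 2 \<tau>" for \<tau> using G that by (simp add: pso_def)
  have bl: "bloch (A + of_real s \<cdot>\<^sub>m B) = bloch A + s *\<^sub>R bloch B"
    if "A \<in> carrier_mat 2 2" "B \<in> carrier_mat 2 2" for A B
    using that by (simp add: bloch_def scaleR_conv_of_real)
  have "bloch (G \<rho>) + s *\<^sub>R bloch (G (bloch_mat m)) = bloch (G \<sigma>) + s *\<^sub>R bloch (G (bloch_mat p))"
    using arg_cong[OF lin, of bloch] \<rho> \<sigma> pm by (simp add: bl Gd density_carrier)
  then have "bloch (G \<rho>) - bloch (G \<sigma>) = s *\<^sub>R (bloch (G (bloch_mat p)) - bloch (G (bloch_mat m)))"
    unfolding scaleR_diff_right by (metis add_diff_cancel_left' add_diff_eq diff_diff_eq2)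
  then have "dist (bloch (G \<rho>)) (bloch (G \<sigma>)) =
      s * dist (bloch (G (bloch_mat p))) (bloch (G (bloch_mat m)))"
    using s by (simp add: dist_norm)
  also have "dist (bloch (G (bloch_mat p))) (bloch (G (bloch_mat m))) \<le> 1"
    using bloch_density[OF Gd[OF pm(1)]] bloch_density[OF Gd[OF pm(2)]]
      dist_triangle3[of "bloch (G (bloch_mat p))" "bloch (G (bloch_mat m))" "(1 / 2, 0)"]
    by (simp add: bloch_ball_def)
  finally show ?thesis using s by (simp add: s_def x_def y_def)
qed

lemma dist_bloch_le_norm_inf:
  assumes "pso 2 G" "pso 2 H" "density 2 \<rho>"
  shows "ereal (2 * dist (bloch (G \<rho>)) (bloch (H \<rho>))) \<le> norm_inf (\<lambda>V. G V - H V)"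
proof -
  have "trace_norm (G \<rho> - H \<rho>) = 2 * dist (bloch (G \<rho>)) (bloch (H \<rho>))"
    using assms by (intro trace_norm_diff_density) (auto simp: pso_def)
  moreover have "ereal (trace_norm (G \<rho> - H \<rho>)) \<le> norm_inf (\<lambda>V. G V - H V)"
    unfolding norm_inf_def using assms(3)
    by (intro SUP_upper) (simp add: trace_norm_density density_carrier)
  ultimately show ?thesis by simp
qed

lemma density_funpow:
  assumes "pso n G" "density n \<rho>" shows "density n ((G ^^ j) \<rho>)"
  using assms by (induction j) (auto simp: pso_def)

text \<open>Telescoping through \<open>G ?h\<close>: the first leg shrinks under \<open>G\<close>,
  and the second is a single application of \<open>G\<close> and \<open>H\<close> to the same
  density matrix.\<close>

lemma dist_bloch_funpow_le:
  assumes G: "pso 2 G" and H: "pso 2 H" and \<rho>: "density 2 \<rho>"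
    and near: "norm_inf (\<lambda>V. G V - H V) \<le> ereal (2 * \<eta>)"
  shows "dist (bloch ((G ^^ j) \<rho>)) (bloch ((H ^^ j) \<rho>)) \<le> real j * \<eta>"
proof (induction j)
  case (Suc j)
  let ?g = "(G ^^ j) \<rho>" and ?h = "(H ^^ j) \<rho>"
  have d: "density 2 ?g" "density 2 ?h" using G H \<rho> by (simp_all add: density_funpow)
  have "dist (bloch (G ?g)) (bloch (G ?h)) \<le> real j * \<eta>"
    using pso_dist_bloch_le[OF G d] Suc by simp
  moreover have "dist (bloch (G ?h)) (bloch (H ?h)) \<le> \<eta>"
    using order_trans[OF dist_bloch_le_norm_inf[OF G H d(2)] near] by simp
  ultimately have "dist (bloch (G ?g)) (bloch (H ?h)) \<le> real j * \<eta> + \<eta>"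
    using dist_triangle[of "bloch (G ?g)" "bloch (H ?h)" "bloch (G ?h)"] by linarith
  then show ?case by (simp add: algebra_simps)
qed simp

text \<open>A nearby solution meets every equation exactly, and at most \<open>k\<close> iterations
  let \<open>G\<close> drift from it by at most \<open>k\<close> times the one-step error.\<close>

lemma near_solutions_eps_satisfies:
  assumes G: "cpso G" and near: "dist_inf G (solutions E) \<le> ereal (\<epsilon> / (3 * real k))"
    and sizes: "\<And>e. e \<in> E \<Longrightarrow> eq_size e \<le> k" and k: "k \<ge> 1" and \<epsilon>: "\<epsilon> > 0"
  shows "eps_satisfies (\<epsilon> / 3) G E"
proof -
  \<comment> \<open>The infimum defining the distance need not be attained, but the Bloch distance is half the
    trace norm, which leaves a factor 2 to spare.\<close>
  define \<eta> where "\<eta> = \<epsilon> / (3 * real k)"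
  have \<eta>: "\<eta> > 0" using k \<epsilon> by (simp add: \<eta>_def)
  then have "dist_inf G (solutions E) < ereal (2 * \<eta>)"
    using near unfolding \<eta>_def[symmetric] by (elim order_le_less_trans) simp
  then obtain H where H: "H \<in> solutions E" and GH: "norm_inf (\<lambda>V. G V - H V) \<le> ereal (2 * \<eta>)"
    unfolding dist_inf_def INF_less_iff using less_imp_le by blast
  have pso: "pso 2 G" "pso 2 H" using G H by (auto simp: solutions_def intro: cpso_imp_pso)
  show ?thesis unfolding eps_satisfies_def
  proof
    fix e assume e: "e \<in> E"
    let ?g = "(G ^^ eq_size e) (ket_bra (eq_bit e))" and ?h = "(H ^^ eq_size e) (ket_bra (eq_bit e))"
    have "Pr0 ?h = eq_prob e" using H e by (auto simp: solutions_def eps_satisfies_def)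
    then have "\<bar>Pr0 ?g - eq_prob e\<bar> \<le> dist (bloch ?g) (bloch ?h)"
      using abs_Pr0_diff_le[of ?g ?h] by simp
    also have "\<dots> \<le> real (eq_size e) * \<eta>"
      using pso density_ket_bra GH by (rule dist_bloch_funpow_le)
    also have "\<dots> \<le> real k * \<eta>" using sizes[OF e] \<eta> by simp
    also have "\<dots> = \<epsilon> / 3" using k by (simp add: \<eta>_def)
    finally show "\<bar>Pr0 ?g - eq_prob e\<bar> \<le> \<epsilon> / 3" .
  qed
qed

section \<open>Oracle programs that sample and compare\<close>

text \<open>Written with a continuation \<open>K\<close>, which receives the number of outcomes 0;
  these are encoded as \<open>False\<close>, hence the \<open>Suc\<close> in the else
  branch.\<close>

primrec sample :: "bool \<Rightarrow> nat \<Rightarrow> nat \<Rightarrow> (nat \<Rightarrow> oracle_program) \<Rightarrow> oracle_program" where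
  "sample b j 0 K = K 0"
| "sample b j (Suc n) K = Query b j (\<lambda>x. sample b j n (\<lambda>m. K (if x then m else Suc m)))"

lemma run_sample:
  assumes "\<O> b j = map_pmf Not (bernoulli_pmf p)" "p \<in> {0..1}"
  shows "run \<O> (sample b j n K) = bind_pmf (binomial_pmf n p) (\<lambda>m. run \<O> (K m))"
proof (induction n arbitrary: K)
  case 0
  then show ?case using assms by (simp add: binomial_pmf_0 bind_return_pmf)
next
  case (Suc n)
  then show ?case
    using assms
    by (auto simp: binomial_pmf_Suc bind_map_pmf bind_assoc_pmf bind_return_pmf intro!: bind_pmf_cong)
qed

lemma queries_sample:
  assumes "\<And>m. queries (K m) \<le> l"
  shows "queries (sample b j n K) \<le> n + l"
  using assms by (induction n arbitrary: K) simp_all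

primrec check :: "real \<Rightarrow> nat \<Rightarrow> equation list \<Rightarrow> oracle_program" where
  "check t n [] = Halt PASS"
| "check t n (e # es) = sample (eq_bit e) (eq_size e) n
     (\<lambda>m. if \<bar>real m / real n - eq_prob e\<bar> \<le> t then check t n es else Halt FAIL)"

lemma queries_check: "queries (check t n es) \<le> length es * n"
  by (induction es) (auto intro!: queries_sample)

definition accept_prob :: "real \<Rightarrow> nat \<Rightarrow> (complex mat \<Rightarrow> complex mat) \<Rightarrow> equation \<Rightarrow> real" where
  "accept_prob t n G e =
     measure_pmf.prob (binomial_pmf n (Pr0 ((G ^^ eq_size e) (ket_bra (eq_bit e)))))
       {m. \<bar>real m / real n - eq_prob e\<bar> \<le> t}"

text \<open>PASS requires every comparison to succeed, and separate equations are tested on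
  independent samples.\<close>

lemma pmf_run_check:
  assumes G: "pso 2 G"
  shows "pmf (run (experimental_oracle G) (check t n es)) PASS = (\<Prod>e\<leftarrow>es. accept_prob t n G e)"
proof (induction es)
  case (Cons e es)
  define p where "p = Pr0 ((G ^^ eq_size e) (ket_bra (eq_bit e)))"
  let ?A = "{m. \<bar>real m / real n - eq_prob e\<bar> \<le> t}" and ?R = "run (experimental_oracle G) (check t n es)"
  have p: "p \<in> {0..1}"
    using Pr0_density[OF density_funpow[OF G density_ket_bra]] by (simp add: p_def)
  have "pmf (run (experimental_oracle G) (check t n (e # es))) PASS =
      pmf (bind_pmf (binomial_pmf n p) (\<lambda>m. if m \<in> ?A then ?R else return_pmf FAIL)) PASS"
    by (simp add: run_sample[OF _ p] experimental_oracle_def p_def if_distrib[of "run _"] cong: if_cong)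
  \<comment> \<open>The remaining run \<open>?R\<close> does not depend on the count
    \<open>m\<close>, so its PASS probability factors out.\<close>
  also have "\<dots> = measure_pmf.expectation (binomial_pmf n p) (\<lambda>m. indicator ?A m * pmf ?R PASS)"
    unfolding pmf_bind by (intro Bochner_Integration.integral_cong) (auto simp: indicator_def)
  also have "\<dots> = accept_prob t n G e * pmf ?R PASS"
    by (simp add: accept_prob_def p_def)
  finally show ?case using Cons by simp
qed simp

lemma pmf_FAIL: "pmf P FAIL = 1 - pmf P PASS"
proof -
  have "set_pmf P \<subseteq> {PASS, FAIL}" using verdict.exhaust by auto
  then have "sum (pmf P) {PASS, FAIL} = 1" by (intro sum_pmf_eq_1) simp_all
  then show ?thesis by simp
qed

section \<open>Concentration and products of acceptance probabilities\<close>

text \<open>Two-sided Hoeffding bound, with the sample size condition solved for a prescribed error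
  \<open>\<gamma>\<close>.\<close>

lemma binomial_deviation:
  assumes p: "p \<in> {0..1}" and n: "n > 0" and t: "t \<ge> 0"
    and tail: "ln (2 / \<gamma>) \<le> 2 * real n * t\<^sup>2" and \<gamma>: "\<gamma> > 0"
  shows "measure_pmf.prob (binomial_pmf n p) {m. t \<le> \<bar>real m / real n - p\<bar>} \<le> \<gamma>"
proof -
  interpret binomial_distribution n p by unfold_locales (rule p)
  have "measure_pmf.prob (binomial_pmf n p) {m. t \<le> \<bar>real m / real n - p\<bar>}
      \<le> 2 * exp (- 2 * real n * t\<^sup>2)"
    using prob_abs_ge'[OF n t] by simp
  also have "\<dots> \<le> 2 * exp (- ln (2 / \<gamma>))"
    using tail by simp
  also have "\<dots> = \<gamma>" using \<gamma> by (simp add: exp_minus)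
  finally show ?thesis .
qed

text \<open>A union bound for independent events. The bounds 0 and 1 are carried along because the
  induction step needs them.\<close>

lemma prod_list_ge_Bernoulli:
  fixes f :: "'a \<Rightarrow> real"
  assumes "\<And>x. x \<in> set xs \<Longrightarrow> 1 - \<gamma> \<le> f x \<and> 0 \<le> f x \<and> f x \<le> 1" and "\<gamma> \<ge> 0"
  shows "1 - real (length xs) * \<gamma> \<le> (\<Prod>x\<leftarrow>xs. f x) \<and> 0 \<le> (\<Prod>x\<leftarrow>xs. f x) \<and> (\<Prod>x\<leftarrow>xs. f x) \<le> 1"
  using assms(1)
proof (induction xs)
  case (Cons x xs)
  let ?p = "\<Prod>x\<leftarrow>xs. f x"
  have x: "1 - \<gamma> \<le> f x" "0 \<le> f x" "f x \<le> 1" using Cons.prems by simp_all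
  have IH: "1 - real (length xs) * \<gamma> \<le> ?p" "0 \<le> ?p" "?p \<le> 1" using Cons by simp_all
  have "0 \<le> (1 - f x) * (1 - ?p)" using x IH by (intro mult_nonneg_nonneg) simp_all
  then have "f x + ?p - 1 \<le> f x * ?p" by (simp add: algebra_simps)
  moreover have "f x * ?p \<le> 1" using x IH by (simp add: mult_le_one)
  ultimately show ?case using x IH by (simp add: algebra_simps)
qed simp

lemma prod_list_le_factor:
  fixes f :: "'a \<Rightarrow> real"
  assumes "\<And>x. 0 \<le> f x \<and> f x \<le> 1" and "y \<in> set xs"
  shows "(\<Prod>x\<leftarrow>xs. f x) \<le> f y"
  using assms(2)
proof (induction xs)
  case (Cons x xs)
  let ?p = "\<Prod>x\<leftarrow>xs. f x"
  \<comment> \<open>With \<open>\<gamma> = 1\<close> the lower bound on each factor is trivial; only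
    the range of the product is wanted.\<close>
  have p: "0 \<le> ?p" "?p \<le> 1" using prod_list_ge_Bernoulli[of xs 1 f] assms(1) by auto
  show ?case
  proof (cases "y = x")
    case True
    then show ?thesis using p assms(1)[of x] by (simp add: mult_left_le)
  next
    case False
    then have "?p \<le> f y" using Cons by simp
    then show ?thesis using p assms(1)[of x] mult_left_le_one_le[of ?p "f x"] by simp
  qed
qed simp

section \<open>Correctness and query count of the tester\<close>

text \<open>The threshold lies midway between \<epsilon>/3 and \<epsilon>, so a wrong comparison
  needs a frequency off by at least \<epsilon>/3. For PASS the errors add up over all equations; for
  FAIL one violated equation suffices.\<close>

lemma check_tester:
  assumes \<epsilon>: "\<epsilon> > 0" and k: "k \<ge> 1" and es: "es \<noteq> []" and n: "n > 0"
    and sizes: "\<And>e. e \<in> set es \<Longrightarrow> eq_size e \<le> k"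
    and rob: "robust \<epsilon> \<delta> (set es)"
    and samples: "ln (6 * real (length es)) \<le> 2 * real n * (\<epsilon> / 3)\<^sup>2"
  shows "tester (\<epsilon> / (3 * real k)) \<delta> (solutions (set es)) (check (2 * \<epsilon> / 3) n es)"
  unfolding tester_def
proof (intro allI impI conjI)
  fix G assume G: "cpso G"
  \<comment> \<open>The error allowed per equation, summing to 1/3; \<open>samples\<close> is the
    Hoeffding condition for it, as \<open>2 / \<gamma>\<close> is 6 times the length.\<close>
  define \<gamma> where "\<gamma> = 1 / (3 * real (length es))"
  have len: "real (length es) \<ge> 1" using es by (simp add: Suc_le_eq)
  have \<gamma>: "0 < \<gamma>" "\<gamma> \<le> 1 / 3" "real (length es) * \<gamma> = 1 / 3"
    using len es by (auto simp: \<gamma>_def field_simps)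
  define P where "P e = Pr0 ((G ^^ eq_size e) (ket_bra (eq_bit e)))" for e
  define B where "B e = binomial_pmf n (P e)" for e
  define acc where "acc = accept_prob (2 * \<epsilon> / 3) n G"
  have pso: "pso 2 G" using G by (rule cpso_imp_pso)
  have P: "P e \<in> {0..1}" for e
    using Pr0_density[OF density_funpow[OF pso density_ket_bra]] by (simp add: P_def)
  have acc: "acc e = measure_pmf.prob (B e) {m. \<bar>real m / real n - eq_prob e\<bar> \<le> 2 * \<epsilon> / 3}" for e
    by (simp add: acc_def accept_prob_def B_def P_def)
  have acc01: "0 \<le> acc e \<and> acc e \<le> 1" for e by (simp add: acc)
  have dev: "measure_pmf.prob (B e) {m. \<epsilon> / 3 \<le> \<bar>real m / real n - P e\<bar>} \<le> \<gamma>" for e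
    unfolding B_def using \<epsilon> n samples \<gamma>(1)
    by (intro binomial_deviation P) (simp_all add: \<gamma>_def)
  note run = pmf_run_check[OF pso, of "2 * \<epsilon> / 3" n es, folded acc_def]
  {
    assume "dist_inf G (solutions (set es)) \<le> ereal (\<epsilon> / (3 * real k))"
    then have close: "\<bar>P e - eq_prob e\<bar> \<le> \<epsilon> / 3" if "e \<in> set es" for e
      using near_solutions_eps_satisfies[OF G _ sizes k \<epsilon>] that
      by (auto simp: eps_satisfies_def P_def)
    have "1 - \<gamma> \<le> acc e" if e: "e \<in> set es" for e
    proof -
      have "1 - acc e = measure_pmf.prob (B e) (UNIV - {m. \<bar>real m / real n - eq_prob e\<bar> \<le> 2 * \<epsilon> / 3})"
        using measure_pmf.prob_compl[of "{m. \<bar>real m / real n - eq_prob e\<bar> \<le> 2 * \<epsilon> / 3}" "B e"]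
        by (simp add: acc)
      also have "\<dots> \<le> measure_pmf.prob (B e) {m. \<epsilon> / 3 \<le> \<bar>real m / real n - P e\<bar>}"
      proof (intro measure_pmf.finite_measure_mono subsetI)
        fix m assume "m \<in> UNIV - {m. \<bar>real m / real n - eq_prob e\<bar> \<le> 2 * \<epsilon> / 3}"
        then have "2 * \<epsilon> / 3 < \<bar>real m / real n - eq_prob e\<bar>" by simp
        with close[OF e] have "\<epsilon> / 3 \<le> \<bar>real m / real n - P e\<bar>" by linarith
        then show "m \<in> {m. \<epsilon> / 3 \<le> \<bar>real m / real n - P e\<bar>}" by simp
      qed simp
      also have "\<dots> \<le> \<gamma>" by (rule dev)
      finally show ?thesis by simp
    qed
    then show "2 / 3 \<le> pmf (run (experimental_oracle G) (check (2 * \<epsilon> / 3) n es)) PASS"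
      unfolding run using prod_list_ge_Bernoulli[of es \<gamma> acc] acc01 \<gamma> by auto
  next
    assume "ereal \<delta> < dist_inf G (solutions (set es))"
    then have "\<not> eps_satisfies \<epsilon> G (set es)" using rob G by (auto simp: robust_def)
    then obtain e where e: "e \<in> set es" and far: "\<epsilon> < \<bar>P e - eq_prob e\<bar>"
      by (auto simp: eps_satisfies_def P_def not_le)
    have "acc e \<le> measure_pmf.prob (B e) {m. \<epsilon> / 3 \<le> \<bar>real m / real n - P e\<bar>}"
      unfolding acc
    proof (intro measure_pmf.finite_measure_mono subsetI)
      fix m assume "m \<in> {m. \<bar>real m / real n - eq_prob e\<bar> \<le> 2 * \<epsilon> / 3}"
      then have "\<bar>real m / real n - eq_prob e\<bar> \<le> 2 * \<epsilon> / 3" by simp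
      with far have "\<epsilon> / 3 \<le> \<bar>real m / real n - P e\<bar>" by linarith
      then show "m \<in> {m. \<epsilon> / 3 \<le> \<bar>real m / real n - P e\<bar>}" by simp
    qed simp
    then have "acc e \<le> 1 / 3" using dev[of e] \<gamma> by simp
    then have "(\<Prod>e\<leftarrow>es. acc e) \<le> 1 / 3"
      using prod_list_le_factor[of acc, OF acc01 e] by simp
    then show "2 / 3 \<le> pmf (run (experimental_oracle G) (check (2 * \<epsilon> / 3) n es)) FAIL"
      unfolding pmf_FAIL run by simp
  }
qed

text \<open>Robustness then puts every CPSO within \<delta> of the solutions, so the FAIL condition
  is vacuous.\<close>

lemma Halt_tester:
  assumes "robust \<epsilon> \<delta> E" and "\<And>G. cpso G \<Longrightarrow> eps_satisfies \<epsilon> G E"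
  shows "tester \<delta>' \<delta> (solutions E) (Halt PASS)"
  using assms by (auto simp: tester_def robust_def not_less[symmetric])

text \<open>The constant \<open>C\<close> is uniform in all parameters. The maximum with 2 matters
  for \<open>d = 1\<close>, where \<open>ln d\<close> vanishes and the bound would allow no
  query.\<close>

theorem theorem6:
  shows "\<exists>C::real. \<forall>(\<epsilon>::real) (\<delta>::real) (d::nat) (k::nat) (E::equation set).
    \<epsilon> > 0 \<and> \<delta> > 0 \<and> k \<ge> 1 \<and>
    finite E \<and> card E = d \<and> (\<forall>e \<in> E. experimental_equation e \<and> eq_size e \<le> k) \<and>
    satisfiable E \<and> robust \<epsilon> \<delta> E \<longrightarrow>
    (\<exists>T. tester (\<epsilon> / (3 * real k)) \<delta> (solutions E) T \<and>
         real (queries T) \<le> C * (real d * ln (max 2 (real d)) / \<epsilon>\<^sup>2))"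
\<comment> \<open>The 20 is 18 from the sample size \<open>x\<close> plus 2 for rounding it
  up.\<close>
proof (intro exI[of _ 20] allI impI, elim conjE)
  fix \<epsilon> \<delta> :: real and d k :: nat and E :: "equation set"
  assume \<epsilon>: "\<epsilon> > 0" and k: "k \<ge> 1" and fin: "finite E" and d: "card E = d"
    and eqs: "\<forall>e \<in> E. experimental_equation e \<and> eq_size e \<le> k" and rob: "robust \<epsilon> \<delta> E"
  define L where "L = ln (max 2 (real d))"
  have L: "L \<ge> ln 2" by (simp add: L_def)
  have ln2: "ln 2 \<ge> (1 / 2 :: real)" using ln2_ge_two_thirds by simp
  show "\<exists>T. tester (\<epsilon> / (3 * real k)) \<delta> (solutions E) T \<and>
         real (queries T) \<le> 20 * (real d * ln (max 2 (real d)) / \<epsilon>\<^sup>2)"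
  proof (cases "\<epsilon> \<ge> 1 \<or> d = 0")
    \<comment> \<open>For large \<epsilon> the bound may be below 1, so that no query is allowed.\<close>
    case True
    \<comment> \<open>Either there is no equation, or \<epsilon> is at least the distance of any two
      numbers in the unit interval.\<close>
    have "eps_satisfies \<epsilon> G E" if G: "cpso G" for G
      unfolding eps_satisfies_def
    proof
      fix e assume e: "e \<in> E"
      then have "\<epsilon> \<ge> 1" using True d fin by auto
      moreover have "0 \<le> eq_prob e" "eq_prob e \<le> 1"
        using eqs e by (auto simp: experimental_equation_def)
      ultimately show "\<bar>Pr0 ((G ^^ eq_size e) (ket_bra (eq_bit e))) - eq_prob e\<bar> \<le> \<epsilon>"
        using Pr0_density[OF density_funpow[OF cpso_imp_pso[OF G] density_ket_bra, of "eq_size e" "eq_bit e"]]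
        by linarith
    qed
    then have "tester (\<epsilon> / (3 * real k)) \<delta> (solutions E) (Halt PASS)"
      using Halt_tester[OF rob] by blast
    moreover have "real (queries (Halt PASS)) \<le> 20 * (real d * L / \<epsilon>\<^sup>2)"
      using L ln2 by simp
    ultimately show ?thesis unfolding L_def by blast
  next
    case False
    obtain es where es: "set es = E" "length es = d"
      using finite_distinct_list[OF fin] distinct_card d by metis
    \<comment> \<open>The exact solution of
      \<open>2 * x * (\<epsilon> / 3)^2 = ln (6 * d)\<close>.\<close>
    define x where "x = 9 * ln (6 * real d) / (2 * \<epsilon>\<^sup>2)"
    define n where "n = nat \<lceil>x\<rceil>"
    have d1: "real d \<ge> 1" using False by simp
    have x: "x > 0" using d1 \<epsilon> by (simp add: x_def)
    have n: "n > 0" "x \<le> real n" "real n \<le> x + 1" using x by (auto simp: n_def)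
    have "2 * real n * (\<epsilon> / 3)\<^sup>2 \<ge> 2 * x * (\<epsilon> / 3)\<^sup>2"
      using n by (intro mult_right_mono) auto
    moreover have "2 * x * (\<epsilon> / 3)\<^sup>2 = ln (6 * real d)"
      using \<epsilon> by (simp add: x_def power2_eq_square)
    ultimately have samples: "ln (6 * real (length es)) \<le> 2 * real n * (\<epsilon> / 3)\<^sup>2"
      by (simp add: es)
    have "tester (\<epsilon> / (3 * real k)) \<delta> (solutions (set es)) (check (2 * \<epsilon> / 3) n es)"
      using False es eqs rob by (intro check_tester \<epsilon> k n samples) auto
    moreover have "real (queries (check (2 * \<epsilon> / 3) n es)) \<le> 20 * (real d * L / \<epsilon>\<^sup>2)"
    proof -
      \<comment> \<open>Enlarging 6 to a power of 2 lets the constant be absorbed through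
        \<open>ln 2 \<le> L\<close>.\<close>
      have "ln (6 * real d) \<le> ln (2 ^ 3 * max 2 (real d))"
        using d1 by simp
      also have "\<dots> = 3 * ln 2 + L"
      proof -
        have "max 2 (real d) > 0" by simp
        then have "ln (2 ^ 3 * max 2 (real d)) = ln (2 ^ 3) + L"
          unfolding L_def by (intro ln_mult_pos) simp_all
        then show ?thesis using ln_realpow[of 2 3] by simp
      qed
      finally have "ln (6 * real d) \<le> 4 * L" using L by simp
      then have "x \<le> 18 * L / \<epsilon>\<^sup>2"
        using \<epsilon> by (simp add: x_def field_simps)
      \<comment> \<open>Pays for rounding up: here \<epsilon> < 1 and \<open>L\<close> is at least
        1/2.\<close>
      moreover have "1 \<le> 2 * L / \<epsilon>\<^sup>2"
      proof -
        have "\<epsilon>\<^sup>2 \<le> 1" using \<epsilon> False by (simp add: power_le_one)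
        then show ?thesis using L ln2 \<epsilon> by (simp add: field_simps)
      qed
      moreover have "18 * L / \<epsilon>\<^sup>2 + 2 * L / \<epsilon>\<^sup>2 = 20 * L / \<epsilon>\<^sup>2"
        by (simp flip: add_divide_distrib)
      ultimately have "real n \<le> 20 * L / \<epsilon>\<^sup>2"
        using n(3) by linarith
      then have "real d * real n \<le> real d * (20 * L / \<epsilon>\<^sup>2)"
        by (intro mult_left_mono) simp_all
      moreover have "real (queries (check (2 * \<epsilon> / 3) n es)) \<le> real d * real n"
        using queries_check[of "2 * \<epsilon> / 3" n es] unfolding es
        by (metis of_nat_le_iff of_nat_mult)
      ultimately show ?thesis by (simp add: mult_ac)
    qed
    ultimately show ?thesis unfolding L_def es by blast
  qed
qed

end
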